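(* Let $d\ge1$ and $n\ge1$ be integers and let $S_d\subset\mathbb{R}^d$ be a simplex (the convex hull of $d+1$ points in general position). If $F\subset S_d$ is a Fejér set of degree $n$, then $F$ is also a set of Fekete points of degree $n$ for $S_d$.
   Context: Let $\mathcal{P}_n(\mathbb{R}^d)$ be the space of real polynomials of total degree at most $n$ in $d$ variables, of dimension $N=\binom{n+d}{d}$, and let $p_1,\dots,p_N$ be a basis of it. For points $\mathbf x_1,\dots,\mathbf x_N\in S_d$ put $\mathrm{vdm}(\mathbf x_1,\dots,\mathbf x_N)=\det([p_j(\mathbf x_i)]_{1\le i,j\le N})$. If this is nonzero, the fundamental Lagrange polynomials $\ell_1,\dots,\ell_N\in\mathcal{P}_n(\mathbb{R}^d)$ are those determined by $\ell_i(\mathbf x_j)=\delta_{ij}$. Fekete points: a set $\{\mathbf x_1,\dots,\mathbf x_N\}\subset S_d$ of $N$ distinct points is a set of Fekete points of degree $n$ if $(\mathbf x_1,\dots,\mathbf x_N)$ maximizes $|\mathrm{vdm}|$ over $S_d^N$. Fejér set: a set $F=\{\mathbf x_1,\dots,\mathbf x_N\}\subset S_d$ of $N$ distinct points, with nonzero Vandermonde determinant (so that the Lagrange polynomials of degree $n$ exist), is a Fejér set (of degree $n$; its elements are called Fejér points) if $\max_{\mathbf x\in S_d}\sum_{i=1}^{N}\ell_i^2(\mathbf x)=1$. *)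

theory Defs
  imports
    "HOL-Analysis.Analysis"
    "HOL-Library.Function_Algebras"
    "Jordan_Normal_Form.Determinant"
begin

(* Release the infix symbols for the Euclidean-space operations on real^'d. *)
no_notation vec_index (infixl \<open>$\<close> 100)
no_notation scalar_prod (infix \<open>\<bullet>\<close> 70)

global_interpretation real_fun: vector_space "\<lambda>(c::real) (f::'a \<Rightarrow> real). (\<lambda>x. c * f x)"
  by unfold_locales (auto simp: fun_eq_iff algebra_simps)

(* Real polynomials are identified with the functions they induce on R^d, which is harmless
   because the field of real numbers is infinite. *)

definition monomial_fun :: "('d::finite \<Rightarrow> nat) \<Rightarrow> real^'d \<Rightarrow> real" where
  "monomial_fun \<alpha> x = (\<Prod>k\<in>UNIV. (x $ k) ^ \<alpha> k)"

definition poly_space :: "nat \<Rightarrow> (real^'d::finite \<Rightarrow> real) set" where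
  "poly_space n = real_fun.span (monomial_fun ` {\<alpha>. (\<Sum>k\<in>UNIV. \<alpha> k) \<le> n})"

(* Families of N functions or points are indexed by 0, ..., N - 1; values of the indexing
   function beyond that range are irrelevant. *)

definition is_poly_basis :: "nat \<Rightarrow> nat \<Rightarrow> (nat \<Rightarrow> real^'d::finite \<Rightarrow> real) \<Rightarrow> bool" where
  "is_poly_basis n N p \<longleftrightarrow>
     inj_on p {..<N} \<and>
     \<not> real_fun.dependent (p ` {..<N}) \<and>
     real_fun.span (p ` {..<N}) = poly_space n"

definition vdm :: "nat \<Rightarrow> (nat \<Rightarrow> real^'d::finite \<Rightarrow> real) \<Rightarrow> (nat \<Rightarrow> real^'d) \<Rightarrow> real" where
  "vdm N p x = Determinant.det (Matrix.mat N N (\<lambda>(i, j). p j (x i)))"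

(* Meaningful only when the Vandermonde determinant of the points is nonzero, in which case
   the polynomial described exists and is unique. *)
definition lagrange_poly ::
  "nat \<Rightarrow> nat \<Rightarrow> (nat \<Rightarrow> real^'d::finite) \<Rightarrow> nat \<Rightarrow> real^'d \<Rightarrow> real" where
  "lagrange_poly n N x i =
     (THE l. l \<in> poly_space n \<and> (\<forall>j<N. l (x j) = (if i = j then 1 else 0)))"

definition is_fekete_set ::
  "nat \<Rightarrow> (nat \<Rightarrow> real^'d::finite \<Rightarrow> real) \<Rightarrow> (real^'d) set \<Rightarrow> (real^'d) set \<Rightarrow> bool" where
  "is_fekete_set N p S F \<longleftrightarrow>
     F \<subseteq> S \<and>
     (\<exists>x. bij_betw x {..<N} F \<and>
          (\<forall>y. (\<forall>i<N. y i \<in> S) \<longrightarrow> \<bar>vdm N p y\<bar> \<le> \<bar>vdm N p x\<bar>))"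

(* The last two conjuncts say that the maximum over S of the sum of squares exists and is 1. *)
definition is_fejer_set ::
  "nat \<Rightarrow> nat \<Rightarrow> (nat \<Rightarrow> real^'d::finite \<Rightarrow> real) \<Rightarrow> (real^'d) set \<Rightarrow> (real^'d) set \<Rightarrow> bool" where
  "is_fejer_set n N p S F \<longleftrightarrow>
     F \<subseteq> S \<and>
     (\<exists>x. bij_betw x {..<N} F \<and>
          vdm N p x \<noteq> 0 \<and>
          (\<exists>z\<in>S. (\<Sum>i<N. (lagrange_poly n N x i z)\<^sup>2) = 1) \<and>
          (\<forall>z\<in>S. (\<Sum>i<N. (lagrange_poly n N x i z)\<^sup>2) \<le> 1))"

end

(* If x is a Fejer configuration with Lagrange polynomials l_1, ..., l_N, then
   vdm(y) = det [l_k(y_i)] * vdm(x). The i-th row of [l_k(y_i)] has squared Euclidean norm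
   sum_k l_k(y_i)^2 <= 1, so Hadamard's inequality gives |vdm(y)| <= |vdm(x)|.
   Hadamard's inequality itself is obtained by replacing the rows one after the other by their
   normalised cofactor vectors, which makes the matrix orthogonal. *)

theory Submission
  imports Defs
begin

text \<open>Downward induction on \<open>k\<close>, from \<open>n\<close> to 0. Letting
  \<open>j\<close> range over all rows makes the first \<open>k\<close> rows orthogonal to the later
  ones as well. This survives the step, since the cofactor vector of row \<open>k\<close> is
  orthogonal to every other row, before or after it.\<close>

lemma det_squared_le_prod_orthonormal_rows:
  fixes A :: "real Matrix.mat"
  assumes "A \<in> carrier_mat n n" and "k \<le> n"
    and "\<And>i j. i < k \<Longrightarrow> j < n \<Longrightarrow> (\<Sum>m<n. A $$ (i,m) * A $$ (j,m)) = (if i = j then 1 else 0)"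
  shows "(Determinant.det A)\<^sup>2 \<le> (\<Prod>i<n. \<Sum>j<n. (A $$ (i,j))\<^sup>2)"
  using assms(2,1,3)
proof (induction k arbitrary: A rule: inc_induct)
  case base
  \<comment> \<open>For \<open>k = n\<close> the matrix is orthogonal, and both sides of the
    inequality equal 1.\<close>
  have "A * transpose_mat A = 1\<^sub>m n"
    using base by (auto simp: scalar_prod_def atLeast0LessThan intro!: eq_matI)
  then have "Determinant.det A * Determinant.det A = 1"
    using det_mult[OF base(1), of "transpose_mat A"] Determinant.det_transpose[OF base(1)] base(1) by simp
  moreover have "(\<Sum>j<n. (A $$ (i,j))\<^sup>2) = 1" if "i < n" for i
    using base(2)[OF that that] by (simp add: power2_eq_square)
  ultimately show ?case by (simp add: power2_eq_square)
next
  case (step k A)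
  note A = step.prems(1)
  define c where "c j = cofactor A k j" for j
  define s where "s = sqrt (\<Sum>j<n. (c j)\<^sup>2)"
  have s2: "s\<^sup>2 = (\<Sum>j<n. (c j)\<^sup>2)" unfolding s_def by (simp add: sum_nonneg)
  have det_A: "Determinant.det A = (\<Sum>j<n. A $$ (k,j) * c j)"
    unfolding c_def using laplace_expansion_row[OF A \<open>k < n\<close>] .
  \<comment> \<open>Cauchy-Schwarz for the Laplace expansion along row \<open>k\<close>;
    \<open>s\<close> is the norm of the cofactor vector.\<close>
  have det_A_le: "(Determinant.det A)\<^sup>2 \<le> (\<Sum>j<n. (A $$ (k,j))\<^sup>2) * s\<^sup>2"
    unfolding det_A s2 by (rule Cauchy_Schwarz_ineq_sum)
  show ?case
  proof (cases "s = 0")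
    \<comment> \<open>All cofactors of row \<open>k\<close> vanish and cannot be normalised, but
      then the determinant is 0.\<close>
    case True
    then have "(Determinant.det A)\<^sup>2 \<le> 0" using det_A_le by simp
    also have "\<dots> \<le> (\<Prod>i<n. \<Sum>j<n. (A $$ (i,j))\<^sup>2)" by (intro prod_nonneg sum_nonneg) auto
    finally show ?thesis .
  next
    case False
    define B where "B = Matrix.mat n n (\<lambda>(i,j). if i = k then c j / s else A $$ (i,j))"
    have B: "B \<in> carrier_mat n n" unfolding B_def by simp
    \<comment> \<open>Cofactors along row \<open>k\<close> ignore that row, so A and B share them.
      Expanding det B then gives exactly \<open>s\<close>, the factor in
      \<open>det_A_le\<close>.\<close>
    have "cofactor B k j = c j" if "j < n" for j
    proof -
      have "mat_delete B k j = mat_delete A k j"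
        using A \<open>k < n\<close> that by (auto simp: mat_delete_def B_def intro!: eq_matI)
      then show ?thesis unfolding c_def cofactor_def by simp
    qed
    then have "Determinant.det B = (\<Sum>j<n. c j / s * c j)"
      unfolding laplace_expansion_row[OF B \<open>k < n\<close>] using \<open>k < n\<close> by (intro sum.cong) (auto simp: B_def)
    also have "\<dots> = s\<^sup>2 / s" unfolding s2 by (simp add: sum_divide_distrib power2_eq_square)
    finally have det_B: "Determinant.det B = s" using False by (simp add: power2_eq_square)
    \<comment> \<open>An off-diagonal entry of A times its adjugate, which is det A times the
      identity.\<close>
    have c_orth: "(\<Sum>m<n. A $$ (i,m) * c m) = 0" if "i < n" "i \<noteq> k" for i
    proof -
      have "(A * adj_mat A) $$ (i,k) = 0" using adj_mat(2)[OF A] that \<open>k < n\<close> by simp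
      then show ?thesis
        using A that \<open>k < n\<close> by (simp add: adj_mat_def scalar_prod_def atLeast0LessThan c_def)
    qed
    have c_unit: "(\<Sum>m<n. c m * c m / (s * s)) = 1"
      using s2[symmetric] False by (simp flip: sum_divide_distrib add: power2_eq_square)
    have orth: "(\<Sum>m<n. B $$ (i,m) * B $$ (j,m)) = (if i = j then 1 else 0)"
      if "i < Suc k" "j < n" for i j
    proof -
      consider "i = k" "j = k" | "i = k" "j \<noteq> k" | "i < k" "j = k" | "i < k" "j \<noteq> k"
        using \<open>i < Suc k\<close> by linarith
      then show ?thesis
      proof cases
        case 1
        then show ?thesis using c_unit \<open>k < n\<close> by (simp add: B_def)
      next
        case 2
        then show ?thesis using c_orth[of j] that \<open>k < n\<close>
          by (simp add: B_def mult.commute flip: sum_divide_distrib)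
      next
        case 3
        then show ?thesis using c_orth[of i] that \<open>k < n\<close>
          by (simp add: B_def flip: sum_divide_distrib)
      next
        case 4
        then show ?thesis using step.prems(2)[of i j] that \<open>k < n\<close> by (simp add: B_def)
      qed
    qed
    have norm_B: "(\<Sum>j<n. (B $$ (i,j))\<^sup>2) = (if i = k then 1 else \<Sum>j<n. (A $$ (i,j))\<^sup>2)"
      if "i < n" for i
      using that c_unit by (simp add: B_def power2_eq_square)
    have "(Determinant.det A)\<^sup>2 \<le> (\<Sum>j<n. (A $$ (k,j))\<^sup>2) * (Determinant.det B)\<^sup>2"
      using det_A_le det_B by simp
    also have "\<dots> \<le> (\<Sum>j<n. (A $$ (k,j))\<^sup>2) * (\<Prod>i<n. \<Sum>j<n. (B $$ (i,j))\<^sup>2)"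
      by (intro mult_left_mono step.IH[OF B orth] sum_nonneg) auto
    \<comment> \<open>Row \<open>k\<close> of B is a unit vector and contributes the factor 1; the
      factor in front puts the squared norm of row \<open>k\<close> of A in its place.\<close>
    also have "(\<Prod>i<n. \<Sum>j<n. (B $$ (i,j))\<^sup>2) = (\<Prod>i\<in>{..<n} - {k}. \<Sum>j<n. (A $$ (i,j))\<^sup>2)"
      using \<open>k < n\<close> by (simp add: norm_B prod.remove[of _ k])
    also have "(\<Sum>j<n. (A $$ (k,j))\<^sup>2) * \<dots> = (\<Prod>i<n. \<Sum>j<n. (A $$ (i,j))\<^sup>2)"
      using \<open>k < n\<close> by (simp add: prod.remove[of _ k])
    finally show ?thesis .
  qed
qed

lemma Hadamard_inequality:
  fixes A :: "real Matrix.mat"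
  assumes "A \<in> carrier_mat n n"
  shows "(Determinant.det A)\<^sup>2 \<le> (\<Prod>i<n. \<Sum>j<n. (A $$ (i,j))\<^sup>2)"
  \<comment> \<open>At \<open>k = 0\<close> the orthonormality assumption is vacuous.\<close>
  using det_squared_le_prod_orthonormal_rows[OF assms, of 0] by simp

lemma sum_fun_apply: "(\<Sum>a\<in>A. f a) x = (\<Sum>a\<in>A. f a x)"
  by (induction A rule: infinite_finite_induct) auto

lemma real_fun_in_span_imageE:
  assumes "inj_on p {..<N::nat}" and "q \<in> real_fun.span (p ` {..<N})"
  obtains c where "\<And>z. q z = (\<Sum>j<N. c j * p j z)"
proof -
  obtain u where "q = (\<Sum>f\<in>p ` {..<N}. (\<lambda>z. u f * f z))"
    using assms(2) real_fun.span_finite[of "p ` {..<N}"] by auto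
  \<comment> \<open>The coefficients \<open>u\<close> belong to functions; injectivity of
    \<open>p\<close> turns them into coefficients of indices.\<close>
  then have "q z = (\<Sum>j<N. u (p j) * p j z)" for z
    using assms(1) by (simp add: sum.reindex sum_fun_apply)
  then show thesis by (rule that)
qed

lemma real_fun_lincomb_in_span: "(\<lambda>z. \<Sum>j<N. c j * p j z) \<in> real_fun.span (p ` {..<N::nat})"
proof -
  have "(\<Sum>j<N. (\<lambda>z. c j * p j z)) \<in> real_fun.span (p ` {..<N})"
    by (intro real_fun.span_sum real_fun.span_scale real_fun.span_base) auto
  also have "(\<Sum>j<N. (\<lambda>z. c j * p j z)) = (\<lambda>z. \<Sum>j<N. c j * p j z)"
    by (auto simp: sum_fun_apply)
  finally show ?thesis .
qed

text \<open>Column \<open>k\<close> of the inverse Vandermonde matrix holds the coefficients of the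
  k-th Lagrange polynomial: \<open>PQ\<close> yields the interpolation conditions, \<open>QP\<close>
  uniqueness.\<close>

lemma lagrange_poly_eq:
  fixes p :: "nat \<Rightarrow> real^'d::finite \<Rightarrow> real"
  assumes basis: "is_poly_basis n N p"
    and Q: "Q \<in> carrier_mat N N"
    and PQ: "Matrix.mat N N (\<lambda>(i, j). p j (x i)) * Q = 1\<^sub>m N"
    and QP: "Q * Matrix.mat N N (\<lambda>(i, j). p j (x i)) = 1\<^sub>m N"
    and "k < N"
  shows "lagrange_poly n N x k = (\<lambda>z. \<Sum>j<N. Q $$ (j,k) * p j z)" (is "_ = ?l")
  unfolding lagrange_poly_def
proof (rule the_equality)
  have "?l (x i) = (if k = i then 1 else 0)" if "i < N" for i
  proof -
    have "?l (x i) = (Matrix.mat N N (\<lambda>(i, j). p j (x i)) * Q) $$ (i,k)"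
      using Q that \<open>k < N\<close> by (simp add: scalar_prod_def atLeast0LessThan mult.commute)
    then show ?thesis unfolding PQ using that \<open>k < N\<close> by auto
  qed
  then show "?l \<in> poly_space n \<and> (\<forall>j<N. ?l (x j) = (if k = j then 1 else 0))"
    using basis real_fun_lincomb_in_span[where N = N and p = p] unfolding is_poly_basis_def by metis
next
  fix l assume l: "l \<in> poly_space n \<and> (\<forall>j<N. l (x j) = (if k = j then 1 else 0))"
  then obtain c where c: "\<And>z. l z = (\<Sum>j<N. c j * p j z)"
    using real_fun_in_span_imageE basis unfolding is_poly_basis_def by metis
  have "c j = Q $$ (j,k)" if "j < N" for j
  proof -
    \<comment> \<open>Writing P for the Vandermonde matrix, c = Q (P c), and P c lists the values of
      \<open>l\<close> at the nodes, which form the k-th unit vector.\<close>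
    have "c j = (\<Sum>m<N. (Q * Matrix.mat N N (\<lambda>(i, j). p j (x i))) $$ (j,m) * c m)"
      unfolding QP using that by (simp add: if_distrib[of "\<lambda>u. u * _"] cong: if_cong)
    also have "\<dots> = (\<Sum>m<N. \<Sum>i<N. Q $$ (j,i) * p m (x i) * c m)"
      using Q that by (simp add: scalar_prod_def atLeast0LessThan sum_distrib_right)
    also have "\<dots> = (\<Sum>i<N. Q $$ (j,i) * l (x i))"
      unfolding c by (subst sum.swap) (simp add: sum_distrib_left mult_ac)
    also have "\<dots> = (\<Sum>i<N. if k = i then Q $$ (j,i) else 0)"
      using l by (intro sum.cong) auto
    also have "\<dots> = Q $$ (j,k)" using \<open>k < N\<close> by simp
    finally show ?thesis .
  qed
  then show "l = ?l" using c by auto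
qed

text \<open>Interpolation reproduces each basis polynomial: p_j(y_i) is the sum over k of l_k(y_i)
  p_j(x_k). In matrix form this is \<open>L * P x = P y\<close>, and determinants are
  multiplicative.\<close>

lemma vdm_eq_det_lagrange_times_vdm:
  fixes p :: "nat \<Rightarrow> real^'d::finite \<Rightarrow> real"
  assumes basis: "is_poly_basis n N p" and "vdm N p x \<noteq> 0"
  shows "vdm N p y
    = Determinant.det (Matrix.mat N N (\<lambda>(i, k). lagrange_poly n N x k (y i))) * vdm N p x"
proof -
  define P where "P v = Matrix.mat N N (\<lambda>(i, j). p j (v i))" for v
  define L where "L = Matrix.mat N N (\<lambda>(i, k). lagrange_poly n N x k (y i))"
  have P: "P v \<in> carrier_mat N N" for v unfolding P_def by simp
  have L: "L \<in> carrier_mat N N" unfolding L_def by simp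
  \<comment> \<open>A nonzero determinant makes \<open>P x\<close> a unit of the matrix ring, hence
    two-sidedly invertible; \<open>()\<close> merely fills the record extension of
    \<open>ring_mat\<close>.\<close>
  obtain Q where Q: "Q \<in> carrier_mat N N" and QP: "Q * P x = 1\<^sub>m N" and PQ: "P x * Q = 1\<^sub>m N"
    using det_non_zero_imp_unit[OF P, of x "()"] assms(2)
    unfolding vdm_def P_def[symmetric] Units_def ring_mat_def by auto
  have "L = P y * Q"
    using Q by (auto intro!: eq_matI sum.cong
        simp: L_def P_def scalar_prod_def atLeast0LessThan mult.commute
          lagrange_poly_eq[OF basis Q PQ[unfolded P_def] QP[unfolded P_def]])
  then have "L * P x = P y"
    using assoc_mult_mat[OF P Q P] QP right_mult_one_mat[OF P] by simp
  then show ?thesis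
    using det_mult[OF L P, of x] unfolding vdm_def P_def[symmetric] L_def[symmetric] by simp
qed

theorem proposition0p6:
  fixes n N :: nat
    and p :: "nat \<Rightarrow> real^'d::finite \<Rightarrow> real"
    and S F :: "(real^'d) set"
  assumes "n \<ge> 1"
    and "N = (n + CARD('d)) choose CARD('d)"
    and "is_poly_basis n N p"
    and "int CARD('d) simplex S"
    and "is_fejer_set n N p S F"
  shows "is_fekete_set N p S F"
proof -
  obtain x where "F \<subseteq> S" and x: "bij_betw x {..<N} F" and nz: "vdm N p x \<noteq> 0"
    and le1: "\<And>z. z \<in> S \<Longrightarrow> (\<Sum>k<N. (lagrange_poly n N x k z)\<^sup>2) \<le> 1"
    using assms(5) unfolding is_fejer_set_def by blast
  have "\<bar>vdm N p y\<bar> \<le> \<bar>vdm N p x\<bar>" if y: "\<forall>i<N. y i \<in> S" for y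
  proof -
    define L where "L = Matrix.mat N N (\<lambda>(i, k). lagrange_poly n N x k (y i))"
    have "(Determinant.det L)\<^sup>2 \<le> (\<Prod>i<N. \<Sum>k<N. (L $$ (i,k))\<^sup>2)"
      by (rule Hadamard_inequality) (simp add: L_def)
    also have "\<dots> \<le> 1"
      using y le1 by (intro prod_le_1) (auto simp: L_def intro!: sum_nonneg)
    finally have "\<bar>Determinant.det L\<bar> \<le> 1" by (simp add: abs_square_le_1)
    then have "\<bar>Determinant.det L\<bar> * \<bar>vdm N p x\<bar> \<le> 1 * \<bar>vdm N p x\<bar>"
      by (intro mult_right_mono) auto
    then show ?thesis
      using vdm_eq_det_lagrange_times_vdm[OF assms(3) nz, of y] by (simp add: L_def abs_mult)
  qed
  \<comment> \<open>The enumeration \<open>x\<close> that witnesses the Fejer property also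
    witnesses maximality.\<close>
  then show ?thesis unfolding is_fekete_set_def using \<open>F \<subseteq> S\<close> x by blast
qed

end
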